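(* Let $\omega:[0,\infty)\to\mathbb{R}^3$ be bounded, let $R:[0,\infty)\to\mathrm{SO}(3)$ satisfy $\dot R=R\,\omega_\times$, and put $\Omega:=R\omega$. Let $\alpha_i,\beta_i\in\mathbb{R}^3$ be constant, linearly independent vectors, and let $k_\alpha,k_\beta,l_\alpha,l_\beta>0$ be constants. Then the equilibrium point $(\bar E_\alpha,\bar E_\beta,\bar E_b)=(0,0,0)$ of the time-varying system on $\mathbb{R}^3\times\mathbb{R}^3\times\mathbb{R}^3$ $$\begin{aligned} \dot E_\alpha &= E_b\times(\alpha_i+E_\alpha)-k_\alpha E_\alpha,\\ \dot E_\beta &= E_b\times(\beta_i+E_\beta)-k_\beta E_\beta,\\ \dot E_b &= \Omega(t)\times E_b+l_\alpha E_\alpha\times\alpha_i+l_\beta E_\beta\times\beta_i \end{aligned}$$ is uniformly globally asymptotically stable and locally exponentially stable.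
   Context: Notation: for $w\in\mathbb{R}^3$, $w_\times$ is the skew-symmetric $3\times3$ matrix with $w_\times x=w\times x$ for all $x\in\mathbb{R}^3$; $|\cdot|$ is the Euclidean norm. As usual for ODEs, $\omega$ is regular enough in $t$ (e.g. piecewise continuous) for the differential equations to make sense. Origin of the system: a rigid body has orientation $R(t)\in\mathrm{SO}(3)$ with $\dot R=R\omega_\times$. Set $\alpha:=R^T\alpha_i$ and $\beta:=R^T\beta_i$, and let $b\in\mathbb{R}^3$ be a constant gyro bias. The measurements are $\omega_m:=\omega+b$, $\alpha_m:=\alpha$, $\beta_m:=\beta$. The observer is $$\begin{aligned} \dot{\hat\alpha}&=\hat\alpha\times(\omega_m-\hat b)-k_\alpha(\hat\alpha-\alpha_m),\\ \dot{\hat\beta}&=\hat\beta\times(\omega_m-\hat b)-k_\beta(\hat\beta-\beta_m),\\ \dot{\hat b}&=l_\alpha\hat\alpha\times\alpha_m+l_\beta\hat\beta\times\beta_m. \end{aligned}$$ The rotated errors $E_\alpha:=R(\hat\alpha-\alpha)$, $E_\beta:=R(\hat\beta-\beta)$, $E_b:=R(\hat b-b)$ satisfy the system in the claim. Stability notions (standard for nonautonomous systems), with $E=(E_\alpha,E_\beta,E_b)$ and uniformity with respect to the initial time $t_0\ge0$. The origin is uniformly globally asymptotically stable if there is a class-$\mathcal{KL}$ function $\rho$ such that $|E(t)|\le\rho(|E(t_0)|,t-t_0)$ for all $t\ge t_0\ge0$ and all initial conditions $E(t_0)$. It is locally exponentially stable if there are constants $c,k,\lambda>0$ such that $|E(t)|\le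 k\,|E(t_0)|\,e^{-\lambda(t-t_0)}$ for all $t\ge t_0\ge0$ whenever $|E(t_0)|<c$. *)

theory Defs
  imports "HOL-Analysis.Analysis"
begin

subsection \<open>Differential equations with piecewise continuous right-hand side\<close>

definition locally_finite_set :: "real set \<Rightarrow> bool" where
  "locally_finite_set D \<longleftrightarrow> (\<forall>a b. finite (D \<inter> {a..b}))"

text \<open>One-sided limits at the exceptional points are not required, so this includes
  the usual piecewise continuous functions and is slightly more general.\<close>

definition piecewise_continuous_on :: "real set \<Rightarrow> (real \<Rightarrow> 'a::topological_space) \<Rightarrow> bool" where
  "piecewise_continuous_on S f \<longleftrightarrow>
     (\<exists>D. locally_finite_set D \<and> (\<forall>t\<in>S - D. continuous (at t within S) f))"

text \<open>A solution is continuous and satisfies the equation except possibly at the points of a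
  locally finite set, since a right-hand side that jumps in time prevents differentiability there.
  If the right-hand side is jointly continuous, these are exactly the classical solutions.\<close>

definition ode_solution_on ::
    "real set \<Rightarrow> (real \<Rightarrow> 'a \<Rightarrow> 'a) \<Rightarrow> (real \<Rightarrow> 'a::real_normed_vector) \<Rightarrow> bool" where
  "ode_solution_on S f x \<longleftrightarrow>
     continuous_on S x \<and>
     (\<exists>D. locally_finite_set D \<and>
          (\<forall>t\<in>S - D. (x has_vector_derivative f t (x t)) (at t within S)))"

definition equilibrium_point :: "(real \<Rightarrow> 'a \<Rightarrow> 'a) \<Rightarrow> 'a::real_normed_vector \<Rightarrow> bool" where
  "equilibrium_point f x \<longleftrightarrow> (\<forall>t\<ge>0. f t x = 0)"


subsection \<open>Stability of the origin\<close>

definition class_K :: "(real \<Rightarrow> real) \<Rightarrow> bool" where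
  "class_K g \<longleftrightarrow> continuous_on {0..} g \<and> strict_mono_on {0..} g \<and> g 0 = 0"

definition class_KL :: "(real \<Rightarrow> real \<Rightarrow> real) \<Rightarrow> bool" where
  "class_KL \<rho> \<longleftrightarrow>
     continuous_on ({0..} \<times> {0..}) (\<lambda>(r, s). \<rho> r s) \<and>
     (\<forall>s\<ge>0. class_K (\<lambda>r. \<rho> r s)) \<and>
     (\<forall>r\<ge>0. antimono_on {0..} (\<rho> r) \<and> (\<rho> r \<longlongrightarrow> 0) at_top)"

text \<open>The bound on the state for all \<open>t \<ge> t0\<close> is understood to include that solutions
  do not escape in finite time. It is required of every solution on every interval
  \<open>[t0, T]\<close>, hence by restriction of every solution on any interval starting at \<open>t0\<close>.\<close>

definition solutions_bounded_by ::
    "(real \<Rightarrow> 'a \<Rightarrow> 'a) \<Rightarrow> real \<Rightarrow> 'a::real_normed_vector \<Rightarrow> (real \<Rightarrow> real) \<Rightarrow> bool" where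
  "solutions_bounded_by f t0 x0 B \<longleftrightarrow>
     (\<exists>x. ode_solution_on {t0..} f x \<and> x t0 = x0) \<and>
     (\<forall>T x. ode_solution_on {t0..T} f x \<and> x t0 = x0 \<longrightarrow>
        (\<forall>t\<in>{t0..T}. norm (x t) \<le> B (t - t0)))"

definition uniformly_globally_asymptotically_stable ::
    "(real \<Rightarrow> 'a \<Rightarrow> 'a::real_normed_vector) \<Rightarrow> bool" where
  "uniformly_globally_asymptotically_stable f \<longleftrightarrow>
     (\<exists>\<rho>. class_KL \<rho> \<and>
        (\<forall>t0\<ge>0. \<forall>x0. solutions_bounded_by f t0 x0 (\<lambda>s. \<rho> (norm x0) s)))"

definition locally_exponentially_stable ::
    "(real \<Rightarrow> 'a \<Rightarrow> 'a::real_normed_vector) \<Rightarrow> bool" where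
  "locally_exponentially_stable f \<longleftrightarrow>
     (\<exists>c>0. \<exists>k>0. \<exists>\<mu>>0. \<forall>t0\<ge>0. \<forall>x0. norm x0 < c \<longrightarrow>
        solutions_bounded_by f t0 x0 (\<lambda>s. k * norm x0 * exp (- \<mu> * s)))"


subsection \<open>The observer error system\<close>

context includes cross3_syntax
begin

definition cross_matrix :: "real^3 \<Rightarrow> real^3^3" where
  "cross_matrix w = matrix (\<lambda>x. w \<times> x)"

text \<open>The norm of the state space \<open>real^3 \<times> real^3 \<times> real^3\<close> is the Euclidean one.\<close>

definition error_system ::
    "real^3 \<Rightarrow> real^3 \<Rightarrow> real \<Rightarrow> real \<Rightarrow> real \<Rightarrow> real \<Rightarrow> (real \<Rightarrow> real^3) \<Rightarrow>
     real \<Rightarrow> (real^3) \<times> (real^3) \<times> (real^3) \<Rightarrow> (real^3) \<times> (real^3) \<times> (real^3)" where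
  "error_system \<alpha>i \<beta>i k\<alpha> k\<beta> l\<alpha> l\<beta> \<Omega> t = (\<lambda>(E\<alpha>, E\<beta>, Eb).
     ((Eb \<times> (\<alpha>i + E\<alpha>)) - k\<alpha> *\<^sub>R E\<alpha>,
      (Eb \<times> (\<beta>i + E\<beta>)) - k\<beta> *\<^sub>R E\<beta>,
      (\<Omega> t \<times> Eb) + l\<alpha> *\<^sub>R (E\<alpha> \<times> \<alpha>i) + l\<beta> *\<^sub>R (E\<beta> \<times> \<beta>i)))"

end

end

theory Submission
  imports Defs
begin

text \<open>The function \<open>V = l\<alpha> |E\<alpha>|\<^sup>2 + l\<beta> |E\<beta>|\<^sup>2 + |Eb|\<^sup>2\<close> satisfies
  \<open>V' = - 2 l\<alpha> k\<alpha> |E\<alpha>|\<^sup>2 - 2 l\<beta> k\<beta> |E\<beta>|\<^sup>2\<close>, so \<open>|E(t)|\<close> is bounded by a multiple of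
  \<open>|E(t0)|\<close>. The derivative of the cross term \<open>N = E\<alpha> \<bullet> (Eb \<times> \<alpha>) + E\<beta> \<bullet> (Eb \<times> \<beta>)\<close> has the
  leading part \<open>|Eb \<times> \<alpha>|\<^sup>2 + |Eb \<times> \<beta>|\<^sup>2\<close>, which is coercive in \<open>Eb\<close> by linear independence.
  Hence \<open>V - \<epsilon> N\<close> is a strict Lyapunov function on the sublevel sets of \<open>V\<close>, where \<open>\<epsilon>\<close> is of order
  \<open>1 / (1 + |E(t0)|)\<^sup>2\<close>, and \<open>E\<close> decays exponentially with a constant factor independent of
  \<open>E(t0)\<close> and a rate that depends continuously on \<open>|E(t0)|\<close>. This gives both notions of
  stability. Solutions exist globally because scaling the argument of the vector field back to
  a large ball makes it bounded and globally Lipschitz and keeps \<open>V\<close> nonincreasing.\<close>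

subsection \<open>Piecewise continuous differential equations\<close>

lemma continuous_on_ge_iff:
  fixes f :: "real \<Rightarrow> 'a::topological_space"
  shows "continuous_on {a..} f \<longleftrightarrow> (\<forall>b. continuous_on {a..b} f)"
proof
  assume R: "\<forall>b. continuous_on {a..b} f"
  show "continuous_on {a..} f"
    unfolding continuous_on_eq_continuous_within
  proof
    fix t assume t: "t \<in> {a..}"
    have "at t within {a..} = at t within {a..t+1}"
      by (rule at_within_nhd[of t "{..<t+1}"]) (use t in auto)
    then show "continuous (at t within {a..}) f"
      using R t by (simp add: continuous_on_eq_continuous_within)
  qed
qed (auto intro: continuous_on_subset)

text \<open>Continuity off the negligible set \<open>S\<close> gives measurability and the constant
  bound gives integrability; putting finitely many points back does not affect the integral.\<close>

lemma integrable_bounded_off_finite: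
  fixes f :: "real \<Rightarrow> 'a::euclidean_space"
  assumes "finite S" "continuous_on ({a..b} - S) f" "\<And>t. t \<in> {a..b} \<Longrightarrow> norm (f t) \<le> B"
  shows "f integrable_on {a..b}"
proof -
  have S: "{a..b} - S \<in> sets lebesgue"
    using assms(1) by (intro sets.Diff) (auto intro: negligible_imp_sets negligible_finite)
  have "f integrable_on ({a..b} - S)"
  proof (rule measurable_bounded_by_integrable_imp_integrable[of _ _ "\<lambda>_. B"])
    show "f \<in> borel_measurable (lebesgue_on ({a..b} - S))"
      using assms(2) S by (rule continuous_imp_measurable_on_sets_lebesgue)
    show "(\<lambda>_. B) integrable_on ({a..b} - S)"
      by (rule integrable_spike_set[of _ "{a..b}"])
        (auto intro: integrable_const_ivl negligible_subset[OF negligible_finite[OF assms(1)]])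
  qed (use assms S in auto)
  then show ?thesis
    by (rule integrable_spike_set)
      (auto intro: negligible_subset[OF negligible_finite[OF assms(1)]])
qed

lemma
  fixes f :: "real \<Rightarrow> 'a::euclidean_space"
  assumes D: "locally_finite_set D"
    and f: "\<And>t. t \<in> {a..} - D \<Longrightarrow> continuous (at t within {a..}) f"
    and B: "\<And>t. t \<ge> a \<Longrightarrow> norm (f t) \<le> B"
  shows piecewise_continuous_integrable: "f integrable_on {a..b}"
    and piecewise_continuous_primitive_continuous: "continuous_on {a..} (\<lambda>u. integral {a..u} f)"
    and piecewise_continuous_primitive_derivative: "t \<in> {a..} - D \<Longrightarrow>
      ((\<lambda>u. integral {a..u} f) has_vector_derivative f t) (at t within {a..})"
proof -
  have fin: "finite (D \<inter> {a..b})" for b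
    using D by (simp add: locally_finite_set_def)
  have int: "f integrable_on {a..b}" for b
  proof (rule integrable_bounded_off_finite[OF fin[of b]])
    show "continuous_on ({a..b} - D \<inter> {a..b}) f"
      unfolding continuous_on_eq_continuous_within
      by (auto intro!: continuous_within_subset[OF f])
  qed (use B in auto)
  then show "f integrable_on {a..b}" .
  show "continuous_on {a..} (\<lambda>u. integral {a..u} f)"
    unfolding continuous_on_ge_iff using indefinite_integral_continuous_1[OF int] by blast
  assume t: "t \<in> {a..} - D"
  define S where "S = D \<inter> {a..t+1}"
  have "((\<lambda>u. integral {a..u} f) has_vector_derivative f t) (at t within ({a..t+1} - S))"
    by (rule integral_has_vector_derivative_continuous_at[OF int])
      (use t fin in \<open>auto simp: S_def intro!: continuous_within_subset[OF f]\<close>)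
  \<comment> \<open>A finite set is closed, so for \<open>t\<close> outside it both sets agree near
    \<open>t\<close>. At \<open>t = a\<close> this yields the one-sided derivative.\<close>
  moreover have "at t within ({a..t+1} - S) = at t within {a..}"
    by (rule at_within_nhd[of t "{..<t+1} - S"])
      (use t fin[of "t+1"] in \<open>auto simp: S_def intro!: open_Diff finite_imp_closed\<close>)
  ultimately show "((\<lambda>u. integral {a..u} f) has_vector_derivative f t) (at t within {a..})"
    by simp
qed

text \<open>By the fundamental theorem of calculus with finitely many exceptions, the increment of
  \<open>g\<close> is the integral of a nonpositive function.\<close>

lemma nonincreasing_off_finite:
  fixes g :: "real \<Rightarrow> real"
  assumes S: "finite S" and g: "continuous_on {a..b} g"
    and d: "\<And>t. t \<in> {a<..<b} - S \<Longrightarrow> (g has_real_derivative g' t) (at t) \<and> g' t \<le> 0"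
    and t: "t \<in> {a..b}"
  shows "g t \<le> g a"
proof -
  \<comment> \<open>Nothing is known about \<open>g'\<close> at the endpoints and on
    \<open>S\<close>; the value 0 there makes the integrand nonpositive everywhere.\<close>
  define h where "h s = (if s \<in> {a<..<t} - S then g' s else 0)" for s
  have "(h has_integral g t - g a) {a..t}"
    by (rule fundamental_theorem_of_calculus_interior_strong[OF S])
      (use t d in \<open>auto simp: h_def has_real_derivative_iff_has_vector_derivative
          intro: continuous_on_subset[OF g]\<close>)
  moreover have "((\<lambda>_. 0) has_integral (0::real)) {a..t}"
    by simp
  ultimately have "g t - g a \<le> 0"
    by (rule has_integral_le) (use t d in \<open>auto simp: h_def\<close>)
  then show ?thesis by simp
qed

text \<open>The integrating factor \<open>exp (c * (t - a))\<close> turns the differential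
  inequality into monotonicity.\<close>

lemma exponential_decay_off_finite:
  fixes g :: "real \<Rightarrow> real"
  assumes S: "finite S" and g: "continuous_on {a..b} g"
    and d: "\<And>t. t \<in> {a<..<b} - S \<Longrightarrow> (g has_real_derivative g' t) (at t) \<and> g' t \<le> - c * g t"
    and t: "t \<in> {a..b}"
  shows "g t \<le> g a * exp (- c * (t - a))"
proof -
  have "g t * exp (c * (t - a)) \<le> g a * exp (c * (a - a))"
  proof (rule nonincreasing_off_finite[OF S _ _ t])
    fix s assume s: "s \<in> {a<..<b} - S"
    have "g' s + c * g s \<le> 0"
      using d[OF s] by simp
    then have "(g' s + c * g s) * exp (c * (s - a)) \<le> 0"
      by (simp add: mult_nonpos_nonneg)
    moreover have "((\<lambda>t. g t * exp (c * (t - a))) has_real_derivative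
        (g' s + c * g s) * exp (c * (s - a))) (at s)"
      by (rule derivative_eq_intros conjunct1[OF d[OF s]] refl | simp add: algebra_simps)+
    ultimately show "((\<lambda>t. g t * exp (c * (t - a))) has_real_derivative
        (g' s + c * g s) * exp (c * (s - a))) (at s) \<and> (g' s + c * g s) * exp (c * (s - a)) \<le> 0"
      by blast
  qed (intro continuous_intros g)
  then have "g t * exp (c * (t - a)) * exp (- c * (t - a)) \<le> g a * exp (- c * (t - a))"
    by simp
  then show ?thesis
    by (simp add: mult.assoc flip: exp_add)
qed

text \<open>Picard iteration is a contraction for the sup norm weighted by \<open>exp (- 2 * L * (t - t0))\<close>,
  so no gluing of local solutions is needed.\<close>

lemma global_ode_solution:
  fixes F :: "real \<Rightarrow> 'a::euclidean_space \<Rightarrow> 'a"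
  assumes D: "locally_finite_set D"
    and cont: "\<And>t x. t \<in> {t0..} - D \<Longrightarrow> continuous (at t within {t0..}) (\<lambda>s. F s x)"
    and lip: "\<And>t x y. t \<ge> t0 \<Longrightarrow> norm (F t x - F t y) \<le> L * norm (x - y)" and L: "L > 0"
    and bd: "\<And>t x. t \<ge> t0 \<Longrightarrow> norm (F t x) \<le> B"
  shows "\<exists>x. ode_solution_on {t0..} F x \<and> x t0 = x0"
proof -
  have B: "B \<ge> 0"
    using order_trans[OF norm_ge_zero bd[of t0 0]] by simp
  \<comment> \<open>The Lipschitz constant does not depend on time, so \<open>F s (y s)\<close> and
    \<open>F s (y t)\<close> differ by at most \<open>L * norm (y s - y t)\<close>, and only
    continuity in time for a fixed state remains.\<close>
  have Fy: "continuous (at t within {t0..}) (\<lambda>s. F s (y s))"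
    if t: "t \<in> {t0..} - D" and y: "continuous_on {t0..} y" for t y
  proof -
    have yt: "(y \<longlongrightarrow> y t) (at t within {t0..})"
      using y t by (auto simp: continuous_on_def)
    have "((\<lambda>s. F s (y s) - F s (y t)) \<longlongrightarrow> 0) (at t within {t0..})"
    proof (rule Lim_null_comparison)
      show "\<forall>\<^sub>F s in at t within {t0..}. norm (F s (y s) - F s (y t)) \<le> L * norm (y s - y t)"
        by (auto simp: eventually_at_filter lip)
      show "((\<lambda>s. L * norm (y s - y t)) \<longlongrightarrow> 0) (at t within {t0..})"
        using tendsto_mult_right_zero tendsto_norm_zero Lim_null yt by metis
    qed
    moreover have "((\<lambda>s. F s (y t)) \<longlongrightarrow> F t (y t)) (at t within {t0..})"
      using cont[OF t] by (simp add: continuous_within)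
    ultimately have "((\<lambda>s. F s (y s) - F s (y t) + F s (y t)) \<longlongrightarrow> 0 + F t (y t)) (at t within {t0..})"
      by (rule tendsto_add)
    then show ?thesis
      by (simp add: continuous_within)
  qed
  \<comment> \<open>A bounded function \<open>z\<close> stands for a curve divided by the weight, so
    the plain sup norm of \<open>z\<close> is the weighted norm of the curve. \<open>lift\<close>
    restores the weight, \<open>J\<close> is the Picard operator and \<open>T\<close> its weighted
    version; \<open>max t0 t\<close> extends it by the constant \<open>x0\<close> to the left of
    \<open>t0\<close>.\<close>
  define lift where "lift z s = exp (2 * L * (s - t0)) *\<^sub>R apply_bcontfun z s" for z :: "real \<Rightarrow>\<^sub>C 'a" and s
  define J where "J z t = x0 + integral {t0..t} (\<lambda>s. F s (lift z s))" for z t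
  define T where "T z t = exp (- 2 * L * (max t0 t - t0)) *\<^sub>R J z (max t0 t)" for z t
  have clift: "continuous_on A (lift z)" for z A
    unfolding lift_def by (intro continuous_intros continuous_on_apply_bcontfun)
  have fint: "(\<lambda>s. F s (lift z s)) integrable_on {t0..b}" for z b
    by (rule piecewise_continuous_integrable[OF D Fy bd]) (auto intro: clift)
  have cJ: "continuous_on {t0..} (J z)" for z
    unfolding J_def
    by (intro continuous_intros piecewise_continuous_primitive_continuous[OF D Fy bd])
      (auto intro: clift)
  have cT: "continuous_on UNIV (T z)" for z
    unfolding T_def
    by (intro continuous_intros continuous_on_compose2[OF cJ]) auto
  have bT: "norm (T z t) \<le> norm x0 + B / (2 * L)" for z t
  proof -
    define u where "u = max t0 t - t0"
    have u: "u \<ge> 0" by (simp add: u_def)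
    have "norm (integral {t0..max t0 t} (\<lambda>s. F s (lift z s))) \<le> integral {t0..max t0 t} (\<lambda>_. B)"
      by (rule integral_norm_bound_integral) (use fint bd in \<open>auto intro: integrable_const_ivl\<close>)
    then have "norm (integral {t0..max t0 t} (\<lambda>s. F s (lift z s))) \<le> B * u"
      by (simp add: u_def mult.commute)
    then have "norm (J z (max t0 t)) \<le> norm x0 + B * u"
      unfolding J_def by (rule norm_triangle_le[OF add_left_mono])
    then have "norm (T z t) \<le> exp (- (2 * L * u)) * (norm x0 + B * u)"
      by (simp add: T_def u_def[symmetric])
    \<comment> \<open>Isolates a term of the form \<open>v * exp (- v)\<close> with
      \<open>v = 2 * L * u\<close>, which is at most 1: the weight beats the linear growth of
      \<open>J\<close>.\<close>
    also have "\<dots> = exp (- (2 * L * u)) * norm x0 + B / (2 * L) * ((2 * L * u) * exp (- (2 * L * u)))"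
      using L by (simp add: field_simps)
    also have "\<dots> \<le> 1 * norm x0 + B / (2 * L) * 1"
    proof (intro add_mono mult_mono order_refl)
      have "2 * L * u \<le> exp (2 * L * u)"
        using exp_ge_add_one_self[of "2 * L * u"] by linarith
      then show "2 * L * u * exp (- (2 * L * u)) \<le> 1"
        by (simp add: exp_minus divide_simps)
    qed (use L u B in auto)
    finally show ?thesis by simp
  qed
  have Tb: "T z \<in> bcontfun" for z
    using cT bT by (rule bcontfun_normI)
  have "\<exists>!z. Bcontfun (T z) = z"
  proof (rule banach_fix_type[of "1/2"], simp, simp, intro allI)
    fix z w
    have *: "dist (T z t) (T w t) \<le> 1/2 * dist z w" for t
    proof -
      define m where "m = max t0 t"
      have m: "m \<ge> t0" by (simp add: m_def)
      \<comment> \<open>An antiderivative of \<open>L\<close> times the weight is half the weight,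
        hence the contraction factor 1/2.\<close>
      have I: "((\<lambda>s. L * (exp (2 * L * (s - t0)) * dist z w)) has_integral
          (exp (2 * L * (m - t0)) * dist z w / 2 - exp (2 * L * (t0 - t0)) * dist z w / 2)) {t0..m}"
        by (rule fundamental_theorem_of_calculus[OF m])
          (auto intro!: derivative_eq_intros simp flip: has_real_derivative_iff_has_vector_derivative)
      have "norm (integral {t0..m} (\<lambda>s. F s (lift z s)) - integral {t0..m} (\<lambda>s. F s (lift w s)))
          = norm (integral {t0..m} (\<lambda>s. F s (lift z s) - F s (lift w s)))"
        by (simp add: integral_diff fint)
      also have "\<dots> \<le> integral {t0..m} (\<lambda>s. L * (exp (2 * L * (s - t0)) * dist z w))"
      proof (rule integral_norm_bound_integral)
        fix s assume s: "s \<in> {t0..m}"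
        have "norm (lift z s - lift w s) = exp (2 * L * (s - t0)) * dist (apply_bcontfun z s) (apply_bcontfun w s)"
          by (simp add: lift_def dist_norm flip: scaleR_diff_right)
        also have "\<dots> \<le> exp (2 * L * (s - t0)) * dist z w"
          by (simp add: dist_bounded)
        finally show "norm (F s (lift z s) - F s (lift w s)) \<le> L * (exp (2 * L * (s - t0)) * dist z w)"
          using lip[of s "lift z s" "lift w s"] L s by (smt (verit) atLeastAtMost_iff mult_left_mono)
      qed (use fint I in \<open>auto intro: integrable_diff\<close>)
      also have "\<dots> \<le> exp (2 * L * (m - t0)) * dist z w / 2"
        using integral_unique[OF I] by simp
      finally have "norm (J z m - J w m) \<le> exp (2 * L * (m - t0)) * dist z w / 2"
        by (simp add: J_def)
      then have "exp (- 2 * L * (m - t0)) * norm (J z m - J w m)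
          \<le> exp (- 2 * L * (m - t0)) * (exp (2 * L * (m - t0)) * dist z w / 2)"
        by simp
      also have "\<dots> = dist z w / 2"
        by (simp flip: mult.assoc exp_add)
      finally show ?thesis
        by (simp add: T_def dist_norm m_def flip: scaleR_diff_right)
    qed
    show "dist (Bcontfun (T z)) (Bcontfun (T w)) \<le> 1 / 2 * dist z w"
      by (rule dist_bound) (use * in \<open>simp add: Bcontfun_inverse Tb\<close>)
  qed
  then obtain z where "Bcontfun (T z) = z" by blast
  then have z: "apply_bcontfun z = T z"
    using Bcontfun_inverse[OF Tb, of z] by simp
  \<comment> \<open>After cancelling the weight, the fixed point equation is the integral equation
    for the curve \<open>J z\<close>.\<close>
  have lift_J: "lift z t = J z t" if "t \<ge> t0" for t
    using that by (simp add: lift_def z T_def max_def flip: exp_add)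
  have "((J z) has_vector_derivative F t (J z t)) (at t within {t0..})" if t: "t \<in> {t0..} - D" for t
  proof -
    have "((\<lambda>u. integral {t0..u} (\<lambda>s. F s (lift z s))) has_vector_derivative F t (lift z t)) (at t within {t0..})"
      by (rule piecewise_continuous_primitive_derivative[OF D Fy bd t]) (auto intro: clift)
    from has_vector_derivative_add[OF has_vector_derivative_const this, of x0]
    show ?thesis
      using t by (simp add: J_def[abs_def] lift_J)
  qed
  moreover have "J z t0 = x0" by (simp add: J_def)
  ultimately show ?thesis
    using cJ D unfolding ode_solution_on_def by blast
qed

text \<open>Outside the ball the nearest point is \<open>y\<close> rescaled to norm
  \<open>\<rho>\<close>. Truncation by this projection is therefore a rescaling of the state, which
  preserves the sign of the derivative of \<open>V\<close>.\<close>

lemma closest_point_cball_radial: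
  fixes y :: "'a::euclidean_space"
  assumes "\<rho> > 0"
  obtains s where "s \<ge> 0" "closest_point (cball 0 \<rho>) y = s *\<^sub>R y"
proof (cases "norm y \<le> \<rho>")
  case True
  then show ?thesis
    using that[of 1] by (simp add: closest_point_self)
next
  case False
  then have y: "norm y > \<rho>" "norm y > 0"
    using assms by auto
  have "(\<rho> / norm y) *\<^sub>R y = closest_point (cball 0 \<rho>) y"
  proof (rule closest_point_unique)
    show "\<forall>z\<in>cball 0 \<rho>. dist y ((\<rho> / norm y) *\<^sub>R y) \<le> dist y z"
    proof
      fix z :: 'a assume "z \<in> cball 0 \<rho>"
      moreover have "dist y ((\<rho> / norm y) *\<^sub>R y) = norm y - \<rho>"
      proof -
        have "dist y ((\<rho> / norm y) *\<^sub>R y) = norm ((1 - \<rho> / norm y) *\<^sub>R y)"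
          by (simp add: dist_norm algebra_simps)
        also have "\<dots> = (1 - \<rho> / norm y) * norm y"
          using y assms by simp
        finally show ?thesis
          using y by (simp add: algebra_simps)
      qed
      ultimately show "dist y ((\<rho> / norm y) *\<^sub>R y) \<le> dist y z"
        using norm_triangle_ineq2[of y z] by (simp add: dist_norm)
    qed
  qed (use y assms in auto)
  then show ?thesis
    using that[of "\<rho> / norm y"] assms by simp
qed

text \<open>As \<open>r\<close> grows the factor \<open>r\<close> increases strictly and the
  exponential does not decrease, because \<open>rate\<close> is nonincreasing. Positivity of
  \<open>rate\<close> gives the decay in \<open>s\<close>.\<close>

lemma class_KL_exponential:
  fixes rate :: "real \<Rightarrow> real"
  assumes K: "K > 0" and cont: "continuous_on {0..} rate"
    and pos: "\<And>r. r \<ge> 0 \<Longrightarrow> rate r > 0" and anti: "antimono_on {0..} rate"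
  shows "class_KL (\<lambda>r s. K * r * exp (- rate r * s))"
  unfolding class_KL_def
proof (intro conjI allI impI)
  have "continuous_on ({0..} \<times> {0..}) (\<lambda>p. K * fst p * exp (- rate (fst p) * snd p))"
    by (intro continuous_intros continuous_on_compose2[OF cont]) auto
  then show "continuous_on ({0..} \<times> {0..}) (\<lambda>(r, s). K * r * exp (- rate r * s))"
    by (simp add: case_prod_beta')
next
  fix s :: real assume s: "s \<ge> 0"
  have "K * r * exp (- rate r * s) < K * r' * exp (- rate r' * s)" if "0 \<le> r" "r < r'" for r r'
  proof (rule mult_less_le_imp_less)
    have "rate r' \<le> rate r"
      using anti that by (simp add: monotone_on_def)
    then show "exp (- rate r * s) \<le> exp (- rate r' * s)"
      using s by (simp add: mult_right_mono)
  qed (use that K in auto)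
  then show "class_K (\<lambda>r. K * r * exp (- rate r * s))"
    by (auto simp: class_K_def intro!: continuous_intros cont strict_mono_onI)
next
  fix r :: real assume r: "r \<ge> 0"
  show "antimono_on {0..} (\<lambda>s. K * r * exp (- rate r * s))"
    using pos[OF r] K r by (auto simp: monotone_on_def intro!: mult_left_mono)
  have "filterlim (\<lambda>s. rate r * s) at_top at_top"
    using pos[OF r] by (intro filterlim_tendsto_pos_mult_at_top[OF tendsto_const]) (auto intro: filterlim_ident)
  then have "((\<lambda>s. exp (- (rate r * s))) \<longlongrightarrow> 0) at_top"
    by (intro filterlim_compose[OF exp_at_bot]) (simp add: filterlim_uminus_at_bot)
  then show "((\<lambda>s. K * r * exp (- rate r * s)) \<longlongrightarrow> 0) at_top"
    by (auto intro: tendsto_mult_right_zero)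
qed

lemma ode_solution_on_subset:
  assumes "ode_solution_on S F x" "T \<subseteq> S"
  shows "ode_solution_on T F x"
  using assms unfolding ode_solution_on_def
  by (blast intro: continuous_on_subset has_vector_derivative_within_subset)

lemma ode_solution_interior:
  assumes "ode_solution_on {a..b} F x"
  obtains S where "finite S"
    "\<And>t. t \<in> {a<..<b} - S \<Longrightarrow> (x has_vector_derivative F t (x t)) (at t)"
proof -
  obtain D where D: "locally_finite_set D"
      "\<forall>t\<in>{a..b} - D. (x has_vector_derivative F t (x t)) (at t within {a..b})"
    using assms unfolding ode_solution_on_def by blast
  show ?thesis
  proof (rule that)
    show "finite (D \<inter> {a..b})"
      using D by (simp add: locally_finite_set_def)
    fix t assume t: "t \<in> {a<..<b} - D \<inter> {a..b}"
    then have "(x has_vector_derivative F t (x t)) (at t within {a..b})"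
      using D by auto
    then show "(x has_vector_derivative F t (x t)) (at t)"
      using t by (simp add: at_within_Icc_at)
  qed
qed

subsection \<open>Lyapunov functions of the error system\<close>

unbundle cross3_syntax

section \<open>Cross product estimates and coercivity\<close>

lemma norm_cross_le: "norm (x \<times> y) \<le> norm x * norm y"
proof -
  have "(norm (x \<times> y))\<^sup>2 \<le> (norm x * norm y)\<^sup>2"
    using norm_cross_dot[of x y] by (simp flip: norm_cross_dot)
  then show ?thesis
    by (rule power2_le_imp_le) simp
qed

lemma inner_cross_le: "x \<bullet> (y \<times> z) \<le> norm x * norm y * norm z"
proof -
  have "x \<bullet> (y \<times> z) \<le> norm x * norm (y \<times> z)"
    by (rule norm_cauchy_schwarz)
  also have "\<dots> \<le> norm x * (norm y * norm z)"
    by (intro mult_left_mono norm_cross_le norm_ge_zero)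
  finally show ?thesis by (simp add: mult.assoc)
qed

text \<open>A nonzero \<open>e\<close> in the kernel of \<open>g\<close> would have both vectors as
  multiples, making them dependent. So \<open>g\<close> is injective, hence bounded below in finite
  dimension by some \<open>B\<close>, and \<open>\<mu>\<close> is the square of
  \<open>B\<close>.\<close>

lemma independent_cross_coercive:
  fixes \<alpha> \<beta> :: "real^3"
  assumes "\<alpha> \<noteq> \<beta>" "independent {\<alpha>, \<beta>}"
  obtains \<mu> where "\<mu> > 0" "\<And>e. \<mu> * (norm e)\<^sup>2 \<le> (norm (e \<times> \<alpha>))\<^sup>2 + (norm (e \<times> \<beta>))\<^sup>2"
proof -
  define g where "g e = (e \<times> \<alpha>, e \<times> \<beta>)" for e
  have lin: "linear g"
    by (rule linearI) (auto simp: g_def cross_add_left cross_mult_left)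
  have nz: "\<alpha> \<noteq> 0" "\<beta> \<noteq> 0"
    using assms(2) dependent_zero by blast+
  have "e = 0" if "g e = 0" for e
  proof (rule ccontr)
    assume "e \<noteq> 0"
    have "\<exists>c. \<alpha> = c *\<^sub>R e" "\<exists>d. \<beta> = d *\<^sub>R e"
      using that nz \<open>e \<noteq> 0\<close> by (auto simp: g_def zero_prod_def cross_eq_0 collinear_lemma)
    then obtain c d where c: "\<alpha> = c *\<^sub>R e" and d: "\<beta> = d *\<^sub>R e"
      by blast
    with nz have "\<beta> = (d / c) *\<^sub>R \<alpha>"
      by auto
    then have "\<beta> \<in> span {\<alpha>}"
      by (simp add: span_mul span_base)
    then show False
      using assms by (auto simp: dependent_def insert_Diff_if)
  qed
  then have "inj g"
    using lin by (simp add: linear_injective_0)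
  then obtain B where B: "B > 0" "\<And>e. B * norm e \<le> norm (g e)"
    using linear_inj_bounded_below_pos[OF lin] by blast
  have "B\<^sup>2 * (norm e)\<^sup>2 \<le> (norm (e \<times> \<alpha>))\<^sup>2 + (norm (e \<times> \<beta>))\<^sup>2" for e
  proof -
    have "(B * norm e)\<^sup>2 \<le> (norm (g e))\<^sup>2"
      using B by (intro power_mono) auto
    then show ?thesis
      by (simp add: g_def norm_Pair power_mult_distrib)
  qed
  then show ?thesis
    using that[of "B\<^sup>2"] B by simp
qed

text \<open>The rotation enters only through \<open>\<Omega>\<close>, for which a bound
  \<open>w\<close> and piecewise continuity are retained.\<close>

locale observer_error =
  fixes \<alpha> \<beta> :: "real^3" and k\<alpha> k\<beta> l\<alpha> l\<beta> w :: real and \<Omega> :: "real \<Rightarrow> real^3"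
  assumes pos: "k\<alpha> > 0" "k\<beta> > 0" "l\<alpha> > 0" "l\<beta> > 0"
    and independent: "\<alpha> \<noteq> \<beta>" "independent {\<alpha>, \<beta>}"
    and \<Omega>_bounded: "\<And>t. t \<ge> 0 \<Longrightarrow> norm (\<Omega> t) \<le> w"
    and \<Omega>_piecewise: "piecewise_continuous_on {0..} \<Omega>"
begin

abbreviation f :: "real \<Rightarrow> (real^3) \<times> (real^3) \<times> (real^3) \<Rightarrow> (real^3) \<times> (real^3) \<times> (real^3)"
  where "f \<equiv> error_system \<alpha> \<beta> k\<alpha> k\<beta> l\<alpha> l\<beta> \<Omega>"

lemma w_nonneg: "w \<ge> 0"
  using order_trans[OF norm_ge_zero \<Omega>_bounded[of 0]] by simp

section \<open>The quadratic functions and their derivatives along the system\<close>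

definition V :: "(real^3) \<times> (real^3) \<times> (real^3) \<Rightarrow> real" where
  "V = (\<lambda>(a, b, e). l\<alpha> * (a \<bullet> a) + l\<beta> * (b \<bullet> b) + e \<bullet> e)"

definition N :: "(real^3) \<times> (real^3) \<times> (real^3) \<Rightarrow> real" where
  "N = (\<lambda>(a, b, e). a \<bullet> (e \<times> \<alpha>) + b \<bullet> (e \<times> \<beta>))"

text \<open>\<open>dV\<close> and \<open>dN\<close> are the differentials of \<open>V\<close> and
  \<open>N\<close> at the first argument in the direction of the second; with the vector field as
  direction they are the derivatives along solutions.\<close>

definition dV :: "(real^3) \<times> (real^3) \<times> (real^3) \<Rightarrow> (real^3) \<times> (real^3) \<times> (real^3) \<Rightarrow> real" where
  "dV = (\<lambda>(a, b, e) (a', b', e'). 2 * (l\<alpha> * (a \<bullet> a') + l\<beta> * (b \<bullet> b') + e \<bullet> e'))"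

definition dN :: "(real^3) \<times> (real^3) \<times> (real^3) \<Rightarrow> (real^3) \<times> (real^3) \<times> (real^3) \<Rightarrow> real" where
  "dN = (\<lambda>(a, b, e) (a', b', e').
     a' \<bullet> (e \<times> \<alpha>) + a \<bullet> (e' \<times> \<alpha>) + (b' \<bullet> (e \<times> \<beta>) + b \<bullet> (e' \<times> \<beta>)))"

lemma
  assumes x: "(x has_vector_derivative x') (at t)"
  shows V_derivative: "((\<lambda>t. V (x t)) has_real_derivative dV (x t) x') (at t)"
    and N_derivative: "((\<lambda>t. N (x t)) has_real_derivative dN (x t) x') (at t)"
proof -
  define a b e where "a = (\<lambda>t. fst (x t))" and "b = (\<lambda>t. fst (snd (x t)))" and "e = (\<lambda>t. snd (snd (x t)))"
  define a' b' e' where "a' = fst x'" and "b' = fst (snd x')" and "e' = snd (snd x')"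
  have s: "((\<lambda>t. snd (x t)) has_vector_derivative snd x') (at t)"
    by (rule bounded_linear.has_vector_derivative[OF bounded_linear_snd x])
  have D: "(a has_vector_derivative a') (at t)" "(b has_vector_derivative b') (at t)"
      "(e has_vector_derivative e') (at t)"
    unfolding a_def b_def e_def a'_def b'_def e'_def
    using bounded_linear.has_vector_derivative[OF bounded_linear_fst x]
      bounded_linear.has_vector_derivative[OF bounded_linear_fst s]
      bounded_linear.has_vector_derivative[OF bounded_linear_snd s] by auto
  have inner: "((\<lambda>t. p t \<bullet> q t) has_real_derivative p' \<bullet> q t + p t \<bullet> q') (at t)"
    if "(p has_vector_derivative p') (at t)" "(q has_vector_derivative q') (at t)"
    for p q :: "real \<Rightarrow> real^3" and p' q'
    using bounded_bilinear.has_vector_derivative[OF bounded_bilinear_inner that]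
    by (simp add: has_real_derivative_iff_has_vector_derivative add.commute)
  have cross: "((\<lambda>t. e t \<times> c) has_vector_derivative e' \<times> c) (at t)" for c
    by (rule bounded_linear.has_vector_derivative[OF _ D(3)])
      (auto intro!: linearI simp: cross_add_left cross_mult_left simp flip: linear_conv_bounded_linear)
  have xt: "x = (\<lambda>t. (a t, b t, e t))" "x' = (a', b', e')"
    by (auto simp: a_def b_def e_def a'_def b'_def e'_def)
  show "((\<lambda>t. V (x t)) has_real_derivative dV (x t) x') (at t)"
    unfolding xt V_def dV_def
    by (auto intro!: derivative_eq_intros inner[OF D(1) D(1)] inner[OF D(2) D(2)] inner[OF D(3) D(3)]
        simp: inner_commute algebra_simps)
  show "((\<lambda>t. N (x t)) has_real_derivative dN (x t) x') (at t)"
    unfolding xt N_def dN_def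
    by (auto intro!: derivative_eq_intros inner[OF D(1) cross] inner[OF D(2) cross])
qed

lemma continuous_V [continuous_intros]: "continuous_on A x \<Longrightarrow> continuous_on (A :: real set) (\<lambda>t. V (x t))"
  unfolding V_def case_prod_beta' by (intro continuous_intros)

lemma continuous_N [continuous_intros]: "continuous_on A x \<Longrightarrow> continuous_on (A :: real set) (\<lambda>t. N (x t))"
  unfolding N_def case_prod_beta' by (intro continuous_intros continuous_on_cross)

text \<open>Evaluating the vector field at a rescaled state also covers the truncated system below.\<close>

lemma dV_error_system:
  "dV (a, b, e) (f t (s *\<^sub>R (a, b, e))) = - 2 * s * (l\<alpha> * k\<alpha> * (norm a)\<^sup>2 + l\<beta> * k\<beta> * (norm b)\<^sup>2)"
proof -
  have *: "a \<bullet> (e \<times> c) + e \<bullet> (a \<times> c) = 0" for a c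
    by (simp add: cross3_simps)
  have "dV (a, b, e) (f t (s *\<^sub>R (a, b, e))) =
      - 2 * s * (l\<alpha> * k\<alpha> * (a \<bullet> a) + l\<beta> * k\<beta> * (b \<bullet> b))
      + 2 * s * l\<alpha> * (a \<bullet> (e \<times> \<alpha>) + e \<bullet> (a \<times> \<alpha>)) + 2 * s * l\<beta> * (b \<bullet> (e \<times> \<beta>) + e \<bullet> (b \<times> \<beta>))"
    by (simp add: dV_def error_system_def inner_add_right inner_diff_right cross_add_right
        cross_mult_left cross_mult_right dot_cross_self algebra_simps)
  then show ?thesis
    by (simp only: * power2_norm_eq_inner)
qed

definition "m = min 1 (min l\<alpha> l\<beta>)"
definition "M = max 1 (max l\<alpha> l\<beta>)"

lemma m_M: "0 < m" "m \<le> 1" "m \<le> l\<alpha>" "m \<le> l\<beta>" "1 \<le> M" "l\<alpha> \<le> M" "l\<beta> \<le> M"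
  using pos by (auto simp: m_def M_def)

lemma V_bounds: "m * (norm y)\<^sup>2 \<le> V y" "V y \<le> M * (norm y)\<^sup>2"
proof -
  obtain a b e where y: "y = (a, b, e)" by (cases y)
  have "m * (norm a)\<^sup>2 \<le> l\<alpha> * (norm a)\<^sup>2" "m * (norm b)\<^sup>2 \<le> l\<beta> * (norm b)\<^sup>2" "m * (norm e)\<^sup>2 \<le> 1 * (norm e)\<^sup>2"
    by (intro mult_right_mono m_M zero_le_power2)+
  then show "m * (norm y)\<^sup>2 \<le> V y"
    unfolding y V_def by (simp add: norm_Pair distrib_left power2_norm_eq_inner)
  have "l\<alpha> * (norm a)\<^sup>2 \<le> M * (norm a)\<^sup>2" "l\<beta> * (norm b)\<^sup>2 \<le> M * (norm b)\<^sup>2" "1 * (norm e)\<^sup>2 \<le> M * (norm e)\<^sup>2"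
    by (intro mult_right_mono m_M zero_le_power2)+
  then show "V y \<le> M * (norm y)\<^sup>2"
    unfolding y V_def by (simp add: norm_Pair distrib_left power2_norm_eq_inner)
qed

lemma norm_le_of_V_le:
  assumes "V y \<le> V z"
  shows "norm y \<le> sqrt (M / m) * norm z"
proof -
  have "m * (norm y)\<^sup>2 \<le> M * (norm z)\<^sup>2"
    using V_bounds(1)[of y] V_bounds(2)[of z] assms by linarith
  then have "(norm y)\<^sup>2 \<le> M / m * (norm z)\<^sup>2"
    using m_M by (simp add: field_simps)
  then have "sqrt ((norm y)\<^sup>2) \<le> sqrt (M / m * (norm z)\<^sup>2)"
    by (rule real_sqrt_le_mono)
  then show ?thesis
    by (simp only: real_sqrt_mult) simp
qed

text \<open>The formula for \<open>dV\<close> is nonpositive for every scale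
  \<open>s \<ge> 0\<close>. Allowing \<open>s\<close> to vary covers both the error system, with
  \<open>s = 1\<close>, and its radial truncation.\<close>

lemma V_nonincreasing:
  assumes sol: "ode_solution_on {t0..T} F x" and t: "t \<in> {t0..T}"
    and F: "\<And>t y. \<exists>s\<ge>0. F t y = f t (s *\<^sub>R y)"
  shows "V (x t) \<le> V (x t0)"
proof -
  obtain S where S: "finite S"
    and d: "\<And>t. t \<in> {t0<..<T} - S \<Longrightarrow> (x has_vector_derivative F t (x t)) (at t)"
    using ode_solution_interior[OF sol] by blast
  show ?thesis
  proof (rule nonincreasing_off_finite[OF S _ _ t])
    show "continuous_on {t0..T} (\<lambda>t. V (x t))"
      using sol by (auto simp: ode_solution_on_def intro: continuous_V)
    fix t assume t: "t \<in> {t0<..<T} - S"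
    obtain s where s: "s \<ge> 0" "F t (x t) = f t (s *\<^sub>R x t)"
      using F by blast
    obtain a b e where y: "x t = (a, b, e)" by (cases "x t")
    have "dV (x t) (F t (x t)) \<le> 0"
      unfolding s(2) unfolding y dV_error_system using s pos by (simp add: mult_nonneg_nonneg)
    with V_derivative[OF d[OF t]]
    show "((\<lambda>t. V (x t)) has_real_derivative dV (x t) (F t (x t))) (at t) \<and> dV (x t) (F t (x t)) \<le> 0"
      by blast
  qed
qed

text \<open>\<open>A\<close>, \<open>k\<close> and \<open>l\<close> are crude bounds that serve both
  vector components at once; \<open>2 * q\<close> bounds from below the rate at which
  \<open>V\<close> dissipates the squared norms of the two vector errors.\<close>

definition "A = norm \<alpha> + norm \<beta>"
definition "k = k\<alpha> + k\<beta>"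
definition "l = l\<alpha> + l\<beta>"
definition "q = min (l\<alpha> * k\<alpha>) (l\<beta> * k\<beta>)"

lemma nonneg: "A \<ge> 0" "k > 0" "l > 0" "q > 0"
  using pos by (auto simp: A_def k_def l_def q_def)

lemma N_bound: "\<bar>N y\<bar> \<le> A * (norm y)\<^sup>2"
proof -
  obtain a b e where y: "y = (a, b, e)" by (cases y)
  have n: "norm a \<le> norm y" "norm b \<le> norm y" "norm e \<le> norm y"
    unfolding y using norm_fst_le norm_snd_le order_trans by metis+
  have *: "\<bar>v \<bullet> (e \<times> c)\<bar> \<le> norm c * (norm y)\<^sup>2" if "norm v \<le> norm y" for v c
  proof -
    have "\<bar>v \<bullet> (e \<times> c)\<bar> \<le> norm v * norm e * norm c"
      using inner_cross_le[of v e c] inner_cross_le[of "-v" e c] by simp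
    also have "\<dots> \<le> norm y * norm y * norm c"
      using that n by (intro mult_mono) auto
    finally show ?thesis by (simp add: power2_eq_square mult_ac)
  qed
  show ?thesis
    using *[OF n(1), of \<alpha>] *[OF n(2), of \<beta>] unfolding y N_def A_def
    by (simp add: distrib_right)
qed

text \<open>One of the two symmetric halves of \<open>dN\<close>: \<open>c\<close> is
  \<open>\<alpha>\<close> or \<open>\<beta>\<close>, \<open>a\<close> the matching error and
  \<open>u\<close> the feedback in the bias equation. Apart from the square of
  \<open>e \<times> c\<close>, every term carries a factor \<open>norm a\<close>.\<close>

lemma dN_component:
  assumes t: "t \<ge> 0" and k': "0 \<le> k'" "k' \<le> k"
  shows "(e \<times> (c + a) - k' *\<^sub>R a) \<bullet> (e \<times> c) + a \<bullet> ((\<Omega> t \<times> e + u) \<times> c)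
    \<ge> (norm (e \<times> c))\<^sup>2 - norm c * norm a * ((norm e + k + w) * norm e + norm u)"
proof -
  have "- ((e \<times> a) \<bullet> (e \<times> c)) \<le> norm (e \<times> a) * norm e * norm c"
    using inner_cross_le[of "- (e \<times> a)" e c] by simp
  also have "\<dots> \<le> (norm e * norm a) * norm e * norm c"
    by (intro mult_right_mono norm_cross_le) auto
  finally have 1: "- ((e \<times> a) \<bullet> (e \<times> c)) \<le> norm c * norm a * (norm e * norm e)"
    by (simp add: mult_ac)
  have "k' * (a \<bullet> (e \<times> c)) \<le> k' * (norm a * norm e * norm c)"
    using k' by (intro mult_left_mono inner_cross_le) auto
  also have "\<dots> \<le> k * (norm a * norm e * norm c)"
    using k' by (intro mult_right_mono) auto
  finally have 2: "k' * (a \<bullet> (e \<times> c)) \<le> norm c * norm a * (k * norm e)"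
    by (simp add: mult_ac)
  have "norm (\<Omega> t \<times> e) \<le> norm (\<Omega> t) * norm e"
    by (rule norm_cross_le)
  also have "\<dots> \<le> w * norm e"
    using \<Omega>_bounded[OF t] by (rule mult_right_mono) simp
  finally have u: "norm (\<Omega> t \<times> e + u) \<le> w * norm e + norm u"
    by (rule norm_triangle_le[OF add_right_mono])
  have "- (a \<bullet> ((\<Omega> t \<times> e + u) \<times> c)) \<le> norm a * norm (\<Omega> t \<times> e + u) * norm c"
    using inner_cross_le[of "- a" "\<Omega> t \<times> e + u" c] by simp
  also have "\<dots> \<le> norm a * (w * norm e + norm u) * norm c"
    using u by (intro mult_right_mono mult_left_mono) auto
  finally have 3: "- (a \<bullet> ((\<Omega> t \<times> e + u) \<times> c)) \<le> norm c * norm a * (w * norm e + norm u)"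
    by (simp add: mult_ac)
  have "(e \<times> (c + a) - k' *\<^sub>R a) \<bullet> (e \<times> c)
      = (norm (e \<times> c))\<^sup>2 + (e \<times> a) \<bullet> (e \<times> c) - k' * (a \<bullet> (e \<times> c))"
    by (simp add: cross_add_right inner_add_left inner_diff_left power2_norm_eq_inner)
  with 1 2 3 show ?thesis
    by (simp add: distrib_left distrib_right)
qed

text \<open>Adds the two halves. The feedback \<open>u\<close> is at most \<open>l * A * p\<close>,
  and multiplied by another \<open>A * p\<close> it produces the last, quadratic term.\<close>

lemma dN_lower:
  assumes t: "t \<ge> 0"
  shows "dN (a, b, e) (f t (a, b, e)) \<ge> (norm (e \<times> \<alpha>))\<^sup>2 + (norm (e \<times> \<beta>))\<^sup>2
    - A * (norm e + k + w) * norm e * (norm a + norm b) - l * A\<^sup>2 * (norm a + norm b)\<^sup>2"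
proof -
  define u where "u = l\<alpha> *\<^sub>R (a \<times> \<alpha>) + l\<beta> *\<^sub>R (b \<times> \<beta>)"
  define p where "p = norm a + norm b"
  define g where "g = (norm e + k + w) * norm e + l * A * p"
  have c: "c * norm (a \<times> v) \<le> c * (p * A)" if "c \<ge> 0" "norm a \<le> p" "norm v \<le> A" for c a v
    using that norm_ge_zero[of a] norm_ge_zero[of v] by (intro mult_left_mono order_trans[OF norm_cross_le] mult_mono) linarith+
  have "norm u \<le> l\<alpha> * norm (a \<times> \<alpha>) + l\<beta> * norm (b \<times> \<beta>)"
    unfolding u_def using pos by (intro norm_triangle_le) simp
  also have "\<dots> \<le> l\<alpha> * (p * A) + l\<beta> * (p * A)"
    using pos by (intro add_mono c) (auto simp: p_def A_def)
  also have "\<dots> = l * A * p"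
    by (simp add: l_def algebra_simps)
  finally have u: "(norm e + k + w) * norm e + norm u \<le> g"
    by (simp add: g_def)
  have g: "g \<ge> 0"
    using nonneg w_nonneg by (simp add: g_def p_def)
  have ka: "k\<alpha> \<le> k" "k\<beta> \<le> k" "0 \<le> k\<alpha>" "0 \<le> k\<beta>"
    using pos by (auto simp: k_def)
  have "dN (a, b, e) (f t (a, b, e)) =
      (e \<times> (\<alpha> + a) - k\<alpha> *\<^sub>R a) \<bullet> (e \<times> \<alpha>) + a \<bullet> ((\<Omega> t \<times> e + u) \<times> \<alpha>)
      + ((e \<times> (\<beta> + b) - k\<beta> *\<^sub>R b) \<bullet> (e \<times> \<beta>) + b \<bullet> ((\<Omega> t \<times> e + u) \<times> \<beta>))"
    by (simp add: dN_def error_system_def u_def add.assoc)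
  moreover have "norm \<alpha> * norm a * ((norm e + k + w) * norm e + norm u) \<le> norm \<alpha> * norm a * g"
    "norm \<beta> * norm b * ((norm e + k + w) * norm e + norm u) \<le> norm \<beta> * norm b * g"
    by (intro mult_left_mono u, simp)+
  moreover have "norm \<alpha> * norm a * g + norm \<beta> * norm b * g \<le> A * p * g"
  proof -
    have "norm \<alpha> * norm a + norm \<beta> * norm b \<le> A * p"
      by (simp add: A_def p_def algebra_simps)
    then show ?thesis
      using g by (metis distrib_right mult_right_mono)
  qed
  moreover have "A * p * g = A * (norm e + k + w) * norm e * p + l * A\<^sup>2 * p\<^sup>2"
    by (simp add: g_def algebra_simps power2_eq_square)
  ultimately show ?thesis
    using dN_component[OF t ka(3,1), of e \<alpha> a u] dN_component[OF t ka(4,2), of e \<beta> b u]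
    unfolding p_def[symmetric] by linarith
qed

text \<open>The gain \<open>2 * q * P\<close> in \<open>- dV\<close> is split in two: one
  \<open>q * P\<close> absorbs the error terms of \<open>\<epsilon> * dN\<close>, the other supplies
  decay in the vector errors. The leading part of \<open>dN\<close> supplies decay in
  \<open>e\<close>. \<open>C\<close> bounds the state-dependent coefficient of the mixed
  term.\<close>

lemma strict_decay:
  assumes \<mu>: "\<mu> > 0" "\<And>e. \<mu> * (norm e)\<^sup>2 \<le> (norm (e \<times> \<alpha>))\<^sup>2 + (norm (e \<times> \<beta>))\<^sup>2"
    and t: "t \<ge> 0" and C: "A * (norm y + k + w) \<le> C"
    and \<epsilon>: "\<epsilon> \<ge> 0" "\<epsilon> * (C\<^sup>2 / \<mu> + 2 * l * A\<^sup>2) \<le> q" "\<epsilon> * \<mu> / 2 \<le> q"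
  shows "dV y (f t y) - \<epsilon> * dN y (f t y) \<le> - (\<epsilon> * \<mu> / 2) * (norm y)\<^sup>2"
proof -
  obtain a b e where y: "y = (a, b, e)" by (cases y)
  define p P n where "p = norm a + norm b" and "P = (norm a)\<^sup>2 + (norm b)\<^sup>2" and "n = norm e"
  have nn: "p \<ge> 0" "P \<ge> 0" "n \<ge> 0"
    by (auto simp: p_def P_def n_def)
  have p: "p\<^sup>2 \<le> 2 * P"
    using sum_squares_bound[of "norm a" "norm b"] by (simp add: p_def P_def power2_sum)
  have "n \<le> norm y"
    unfolding n_def y using norm_snd_le order_trans by metis
  then have "A * (n + k + w) \<le> C"
    using nonneg by (intro order_trans[OF _ C] mult_left_mono) auto
  then have "A * (n + k + w) * n * p \<le> C * n * p"
    using nn by (intro mult_right_mono)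
  moreover
  \<comment> \<open>Young's inequality, weighted so that half of the coercive term
    \<open>\<mu> * n\<^sup>2\<close> survives.\<close>
  have "0 \<le> (\<mu> * n - C * p)\<^sup>2 / (2 * \<mu>)"
    using \<mu> by simp
  then have "C * n * p \<le> \<mu> / 2 * n\<^sup>2 + C\<^sup>2 / \<mu> / 2 * p\<^sup>2"
    using \<mu> by (simp add: field_simps power2_eq_square)
  moreover have "C\<^sup>2 / \<mu> / 2 * p\<^sup>2 \<le> C\<^sup>2 / \<mu> / 2 * (2 * P)"
    using \<mu> by (intro mult_left_mono p) auto
  moreover have "l * A\<^sup>2 * p\<^sup>2 \<le> l * A\<^sup>2 * (2 * P)"
    using nonneg by (intro mult_left_mono p) auto
  moreover have "dN y (f t y) \<ge> \<mu> * n\<^sup>2 - A * (n + k + w) * n * p - l * A\<^sup>2 * p\<^sup>2"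
    using dN_lower[OF t, of e a b] \<mu>(2)[of e] unfolding y n_def p_def by linarith
  moreover have "(C\<^sup>2 / \<mu> + 2 * l * A\<^sup>2) * P = C\<^sup>2 / \<mu> / 2 * (2 * P) + l * A\<^sup>2 * (2 * P)"
    by (simp add: distrib_right)
  ultimately have "dN y (f t y) \<ge> \<mu> / 2 * n\<^sup>2 - (C\<^sup>2 / \<mu> + 2 * l * A\<^sup>2) * P"
    by linarith
  then have "\<epsilon> * dN y (f t y) \<ge> \<epsilon> * (\<mu> / 2 * n\<^sup>2 - (C\<^sup>2 / \<mu> + 2 * l * A\<^sup>2) * P)"
    using \<epsilon>(1) by (rule mult_left_mono)
  moreover have "\<epsilon> * (C\<^sup>2 / \<mu> + 2 * l * A\<^sup>2) * P \<le> q * P" "\<epsilon> * \<mu> / 2 * P \<le> q * P"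
    using mult_right_mono[OF \<epsilon>(2) nn(2)] mult_right_mono[OF \<epsilon>(3) nn(2)] by auto
  moreover have "dV y (f t y) \<le> - 2 * q * P"
  proof -
    have "q * (norm a)\<^sup>2 \<le> l\<alpha> * k\<alpha> * (norm a)\<^sup>2" "q * (norm b)\<^sup>2 \<le> l\<beta> * k\<beta> * (norm b)\<^sup>2"
      by (auto simp: q_def intro!: mult_right_mono)
    then show ?thesis
      using dV_error_system[of a b e t 1] by (simp add: y P_def distrib_left)
  qed
  moreover have "\<epsilon> * (\<mu> / 2 * n\<^sup>2 - (C\<^sup>2 / \<mu> + 2 * l * A\<^sup>2) * P)
      = \<epsilon> * \<mu> / 2 * n\<^sup>2 - \<epsilon> * (C\<^sup>2 / \<mu> + 2 * l * A\<^sup>2) * P"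
    by (simp add: algebra_simps)
  moreover have "- (\<epsilon> * \<mu> / 2) * (norm y)\<^sup>2 = - (\<epsilon> * \<mu> / 2 * P) - \<epsilon> * \<mu> / 2 * n\<^sup>2"
    by (simp add: y P_def n_def norm_Pair algebra_simps)
  ultimately show ?thesis
    by linarith
qed

text \<open>Along one solution \<open>\<epsilon>\<close> is frozen at a value depending on the
  initial norm \<open>r\<close>. Monotonicity of \<open>V\<close> keeps the state within
  \<open>K * r\<close>, so strict decay applies at all times.\<close>

lemma exponential_estimate:
  obtains K and rate :: "real \<Rightarrow> real" where "K > 0" "continuous_on {0..} rate"
    "\<And>r. r \<ge> 0 \<Longrightarrow> rate r > 0" "antimono_on {0..} rate"
    "\<And>t0 T x t. t0 \<ge> 0 \<Longrightarrow> ode_solution_on {t0..T} f x \<Longrightarrow> t \<in> {t0..T} \<Longrightarrow>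
      norm (x t) \<le> K * norm (x t0) * exp (- rate (norm (x t0)) * (t - t0))"
proof -
  obtain \<mu> where \<mu>: "\<mu> > 0" "\<And>e. \<mu> * (norm e)\<^sup>2 \<le> (norm (e \<times> \<alpha>))\<^sup>2 + (norm (e \<times> \<beta>))\<^sup>2"
    using independent_cross_coercive[OF independent] by blast
  define K where "K = sqrt (M / m)"
  define C where "C r = A * (K * r + k + w)" for r
  \<comment> \<open>Each smallness condition \<open>\<epsilon> * c \<le> g\<close> follows from
    \<open>c / g \<le> d r\<close>. The first two summands serve one condition each, the last two
    together the third. Only the last depends on \<open>r\<close>, and it does so continuously and
    monotonically.\<close>
  define d where "d r = \<mu> / (2 * q) + A * 2 / m + 2 * l * A\<^sup>2 / q + (C r)\<^sup>2 / (\<mu> * q)" for r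
  define \<epsilon> where "\<epsilon> r = 1 / d r" for r
  \<comment> \<open>The dissipation \<open>\<epsilon> * \<mu> / 2\<close> divided by the upper
    constant \<open>2 * M\<close> of \<open>U\<close> gives \<open>2 * rate\<close>; the square root
    at the end halves it.\<close>
  define rate where "rate r = \<epsilon> r * \<mu> / (8 * M)" for r
  have K: "K > 0"
    using m_M by (simp add: K_def)
  have d: "\<mu> / (2 * q) > 0" "A * 2 / m \<ge> 0" "2 * l * A\<^sup>2 / q \<ge> 0" "(C r)\<^sup>2 / (\<mu> * q) \<ge> 0" for r
    using \<mu> nonneg m_M by auto
  have d0: "d r > 0" for r
    using d d(4)[of r] unfolding d_def by linarith
  have \<epsilon>0: "\<epsilon> r > 0" "\<epsilon> r * d r = 1" for r
    using d0[of r] by (auto simp: \<epsilon>_def)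
  have \<epsilon>c: "\<epsilon> r * c \<le> g" if "g > 0" "c / g \<le> d r" for r c g
  proof -
    have "\<epsilon> r * (c / g) \<le> \<epsilon> r * d r"
      using that \<epsilon>0(1)[of r] by (intro mult_left_mono) auto
    then show ?thesis
      using that \<epsilon>0(2)[of r] by (simp add: field_simps)
  qed
  have \<epsilon>: "\<epsilon> r * \<mu> / 2 \<le> q" "\<epsilon> r * A \<le> m / 2" "\<epsilon> r * ((C r)\<^sup>2 / \<mu> + 2 * l * A\<^sup>2) \<le> q" for r
  proof -
    have "\<epsilon> r * (\<mu> / 2) \<le> q"
      by (rule \<epsilon>c) (use nonneg d d(4)[of r] in \<open>simp_all add: d_def\<close>)
    then show "\<epsilon> r * \<mu> / 2 \<le> q" by simp
    show "\<epsilon> r * A \<le> m / 2"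
      by (rule \<epsilon>c) (use m_M d d(4)[of r] in \<open>simp_all add: d_def\<close>)
    have "((C r)\<^sup>2 / \<mu> + 2 * l * A\<^sup>2) / q = (C r)\<^sup>2 / (\<mu> * q) + 2 * l * A\<^sup>2 / q"
      using nonneg \<mu> by (simp add: field_simps)
    then show "\<epsilon> r * ((C r)\<^sup>2 / \<mu> + 2 * l * A\<^sup>2) \<le> q"
      by (intro \<epsilon>c) (use nonneg d d(4)[of r] in \<open>simp_all add: d_def\<close>)
  qed
  have est: "norm (x t) \<le> 2 * K * norm (x t0) * exp (- rate (norm (x t0)) * (t - t0))"
    if t0: "t0 \<ge> 0" and sol: "ode_solution_on {t0..T} f x" and t: "t \<in> {t0..T}" for t0 T x t
  proof -
    define r where "r = norm (x t0)"
    define U where "U y = V y - \<epsilon> r * N y" for y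
    \<comment> \<open>The cross term uses up at most half of the lower bound of \<open>V\<close>, so
      \<open>U\<close> stays equivalent to the squared norm.\<close>
    have EN: "\<bar>\<epsilon> r * N y\<bar> \<le> m / 2 * (norm y)\<^sup>2" for y
    proof -
      have "\<bar>\<epsilon> r * N y\<bar> \<le> \<epsilon> r * (A * (norm y)\<^sup>2)"
        using \<epsilon>0(1)[of r] by (simp add: abs_mult N_bound)
      also have "\<dots> \<le> m / 2 * (norm y)\<^sup>2"
        using mult_right_mono[OF \<epsilon>(2)[of r] zero_le_power2[of "norm y"]] by (simp add: mult.assoc)
      finally show ?thesis .
    qed
    have U: "m / 2 * (norm y)\<^sup>2 \<le> U y" "U y \<le> 2 * M * (norm y)\<^sup>2" for y
    proof -
      show "m / 2 * (norm y)\<^sup>2 \<le> U y"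
        using EN[of y] V_bounds(1)[of y] unfolding U_def by (simp add: abs_le_iff)
      have "m / 2 * (norm y)\<^sup>2 \<le> M * (norm y)\<^sup>2"
        using m_M by (intro mult_right_mono) auto
      then show "U y \<le> 2 * M * (norm y)\<^sup>2"
        using EN[of y] V_bounds(2)[of y] unfolding U_def by (simp add: abs_le_iff)
    qed
    have bound: "norm (x s) \<le> K * r" if "s \<in> {t0..T}" for s
      unfolding K_def r_def
      by (rule norm_le_of_V_le[OF V_nonincreasing[OF sol that]]) (auto intro!: exI[of _ 1])
    obtain S where S: "finite S"
      and dx: "\<And>t. t \<in> {t0<..<T} - S \<Longrightarrow> (x has_vector_derivative f t (x t)) (at t)"
      using ode_solution_interior[OF sol] by blast
    have "U (x t) \<le> U (x t0) * exp (- (2 * rate r) * (t - t0))"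
    proof (rule exponential_decay_off_finite[OF S _ _ t])
      show "continuous_on {t0..T} (\<lambda>t. U (x t))"
        using sol unfolding U_def ode_solution_on_def by (intro continuous_intros) auto
      fix s assume s: "s \<in> {t0<..<T} - S"
      have "dV (x s) (f s (x s)) - \<epsilon> r * dN (x s) (f s (x s)) \<le> - (\<epsilon> r * \<mu> / 2) * (norm (x s))\<^sup>2"
      proof (rule strict_decay[OF \<mu>])
        show "A * (norm (x s) + k + w) \<le> C r"
          unfolding C_def using bound[of s] s nonneg by (intro mult_left_mono) auto
      qed (use s t0 \<epsilon>[of r] \<epsilon>0(1)[of r] in auto)
      also have "\<dots> \<le> - (2 * rate r) * U (x s)"
      proof -
        have "2 * rate r * U (x s) \<le> 2 * rate r * (2 * M * (norm (x s))\<^sup>2)"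
          using \<epsilon>0(1)[of r] \<mu> m_M by (intro mult_left_mono U) (auto simp: rate_def)
        also have "\<dots> = \<epsilon> r * \<mu> / 2 * (norm (x s))\<^sup>2"
          using m_M by (simp add: rate_def)
        finally show ?thesis by simp
      qed
      finally show "((\<lambda>t. U (x t)) has_real_derivative dV (x s) (f s (x s)) - \<epsilon> r * dN (x s) (f s (x s))) (at s)
          \<and> dV (x s) (f s (x s)) - \<epsilon> r * dN (x s) (f s (x s)) \<le> - (2 * rate r) * U (x s)"
        unfolding U_def
        using DERIV_diff[OF V_derivative[OF dx[OF s]] DERIV_cmult[OF N_derivative[OF dx[OF s]]]] by blast
    qed
    also have "\<dots> \<le> 2 * M * r\<^sup>2 * exp (- (2 * rate r) * (t - t0))"
      unfolding r_def by (intro mult_right_mono U) simp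
    finally have "m / 2 * (norm (x t))\<^sup>2 \<le> 2 * M * r\<^sup>2 * exp (- (2 * rate r) * (t - t0))"
      using U(1)[of "x t"] by linarith
    then have "(norm (x t))\<^sup>2 \<le> 4 * (M / m) * r\<^sup>2 * exp (- (2 * rate r) * (t - t0))"
      using m_M by (simp add: field_simps)
    also have "\<dots> = (2 * K * r * exp (- rate r * (t - t0)))\<^sup>2"
      using m_M by (simp add: K_def power_mult_distrib exp_double[symmetric] algebra_simps)
    finally show ?thesis
      unfolding r_def[symmetric]
      by (rule power2_le_imp_le) (use K in \<open>simp add: r_def\<close>)
  qed
  have d_mono: "d r \<le> d r'" if "0 \<le> r" "r \<le> r'" for r r'
  proof -
    have "C r \<le> C r'" "0 \<le> C r"
      unfolding C_def using that nonneg w_nonneg K by (auto intro!: mult_left_mono mult_nonneg_nonneg)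
    then have "(C r)\<^sup>2 / (\<mu> * q) \<le> (C r')\<^sup>2 / (\<mu> * q)"
      using nonneg \<mu> by (intro divide_right_mono power_mono) auto
    then show ?thesis by (simp add: d_def)
  qed
  show ?thesis
  proof (rule that[of "2 * K" rate])
    have "continuous_on {0..} d"
      unfolding d_def C_def using nonneg \<mu> by (intro continuous_intros) auto
    then show "continuous_on {0..} rate"
      unfolding rate_def \<epsilon>_def using m_M d0 by (intro continuous_intros) (auto simp: less_imp_neq[symmetric])
    show "antimono_on {0..} rate"
      unfolding rate_def \<epsilon>_def monotone_on_def using m_M d0 \<mu> d_mono
      by (auto intro!: divide_right_mono mult_right_mono divide_left_mono mult_pos_pos)
    show "rate r > 0" for r
      using \<epsilon>0(1)[of r] \<mu> m_M by (simp add: rate_def)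
  qed (use K est in auto)
qed

subsection \<open>Global existence and stability\<close>

text \<open>The bilinear term is Lipschitz only on bounded sets: its difference is split by changing
  one factor at a time, and \<open>\<rho>\<close> bounds the factor left unchanged.\<close>

lemma cross_scaled_lipschitz:
  assumes "norm e1 \<le> \<rho>" "norm e2 \<le> \<rho>" "norm a1 \<le> \<rho>" "norm (e1 - e2) \<le> D" "norm (a1 - a2) \<le> D" "k' \<ge> 0"
  shows "norm ((e1 \<times> (c + a1) - k' *\<^sub>R a1) - (e2 \<times> (c + a2) - k' *\<^sub>R a2)) \<le> (norm c + 2 * \<rho> + k') * D"
proof -
  have D: "0 \<le> D" "0 \<le> \<rho>"
    using assms norm_ge_zero order_trans by blast+
  have "(e1 \<times> (c + a1) - k' *\<^sub>R a1) - (e2 \<times> (c + a2) - k' *\<^sub>R a2)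
      = (e1 - e2) \<times> (c + a1) + e2 \<times> (a1 - a2) + (- k') *\<^sub>R (a1 - a2)"
    by (simp add: cross3_simps)
  moreover have "norm ((e1 - e2) \<times> (c + a1)) \<le> D * (norm c + \<rho>)"
    using assms D by (intro order_trans[OF norm_cross_le] mult_mono norm_triangle_le) auto
  moreover have "norm (e2 \<times> (a1 - a2)) \<le> \<rho> * D"
    using assms D by (intro order_trans[OF norm_cross_le] mult_mono) auto
  moreover have "norm ((- k') *\<^sub>R (a1 - a2)) \<le> k' * D"
    using assms by (simp add: mult_left_mono)
  ultimately have "norm ((e1 \<times> (c + a1) - k' *\<^sub>R a1) - (e2 \<times> (c + a2) - k' *\<^sub>R a2))
      \<le> D * (norm c + \<rho>) + \<rho> * D + k' * D"
    by (metis (no_types, lifting) add_mono norm_triangle_le)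
  then show ?thesis
    by (simp add: algebra_simps)
qed

lemma error_system_lipschitz_on_ball:
  assumes t: "t \<ge> 0" and y: "norm y \<le> \<rho>" and z: "norm z \<le> \<rho>"
  shows "norm (f t y - f t z) \<le>
    ((norm \<alpha> + 2 * \<rho> + k\<alpha>) + (norm \<beta> + 2 * \<rho> + k\<beta>) + (w + l\<alpha> * norm \<alpha> + l\<beta> * norm \<beta>)) * norm (y - z)"
proof -
  obtain a1 b1 e1 a2 b2 e2 where eq: "y = (a1, b1, e1)" "z = (a2, b2, e2)"
    by (metis prod_cases3)
  have comp: "norm a \<le> norm (a, b, e)" "norm b \<le> norm (a, b, e)" "norm e \<le> norm (a, b, e)"
    for a b e :: "real^3"
    using norm_fst_le norm_snd_le order_trans by metis+
  define D where "D = norm (y - z)"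
  have le: "norm a1 \<le> \<rho>" "norm b1 \<le> \<rho>" "norm e1 \<le> \<rho>" "norm e2 \<le> \<rho>"
    using comp(1)[of a1 b1 e1] comp(2)[of b1 a1 e1] comp(3)[of e1 a1 b1] comp(3)[of e2 a2 b2] y z
    by (auto simp: eq)
  have D: "norm (a1 - a2) \<le> D" "norm (b1 - b2) \<le> D" "norm (e1 - e2) \<le> D"
    using comp(1)[of "a1 - a2" "b1 - b2" "e1 - e2"] comp(2)[of "b1 - b2" "a1 - a2" "e1 - e2"]
      comp(3)[of "e1 - e2" "a1 - a2" "b1 - b2"] by (auto simp: eq D_def)
  let ?a = "(e1 \<times> (\<alpha> + a1) - k\<alpha> *\<^sub>R a1) - (e2 \<times> (\<alpha> + a2) - k\<alpha> *\<^sub>R a2)"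
  let ?b = "(e1 \<times> (\<beta> + b1) - k\<beta> *\<^sub>R b1) - (e2 \<times> (\<beta> + b2) - k\<beta> *\<^sub>R b2)"
  let ?e = "\<Omega> t \<times> (e1 - e2) + l\<alpha> *\<^sub>R ((a1 - a2) \<times> \<alpha>) + l\<beta> *\<^sub>R ((b1 - b2) \<times> \<beta>)"
  have "f t y - f t z = (?a, ?b, ?e)"
    by (simp add: eq error_system_def Cross3.left_diff_distrib Cross3.right_diff_distrib scaleR_diff_right)
  then have "norm (f t y - f t z) \<le> norm ?a + (norm ?b + norm ?e)"
    using norm_Pair_le[of ?a "(?b, ?e)"] norm_Pair_le[of ?b ?e] by simp
  moreover have "norm ?a \<le> (norm \<alpha> + 2 * \<rho> + k\<alpha>) * D" "norm ?b \<le> (norm \<beta> + 2 * \<rho> + k\<beta>) * D"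
    using le D pos by (intro cross_scaled_lipschitz; simp)+
  moreover have "norm ?e \<le> w * D + l\<alpha> * (D * norm \<alpha>) + l\<beta> * (D * norm \<beta>)"
  proof (intro norm_triangle_le add_mono)
    show "norm (\<Omega> t \<times> (e1 - e2)) \<le> w * D"
      using D \<Omega>_bounded[OF t] w_nonneg by (intro order_trans[OF norm_cross_le] mult_mono) auto
    show "norm (l\<alpha> *\<^sub>R ((a1 - a2) \<times> \<alpha>)) \<le> l\<alpha> * (D * norm \<alpha>)"
      using D pos by (simp add: order_trans[OF norm_cross_le] mult_right_mono)
    show "norm (l\<beta> *\<^sub>R ((b1 - b2) \<times> \<beta>)) \<le> l\<beta> * (D * norm \<beta>)"
      using D pos by (simp add: order_trans[OF norm_cross_le] mult_right_mono)
  qed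
  ultimately show ?thesis
    unfolding D_def[symmetric] by (simp add: algebra_simps)
qed

lemma equilibrium: "f t 0 = 0"
  by (simp add: error_system_def zero_prod_def)

lemma solution_exists:
  assumes t0: "t0 \<ge> 0"
  shows "\<exists>x. ode_solution_on {t0..} f x \<and> x t0 = x0"
proof -
  \<comment> \<open>The a priori bound given by \<open>V\<close> for solutions from
    \<open>x0\<close>; adding 1 keeps the radius positive when \<open>x0 = 0\<close>.\<close>
  define \<rho> where "\<rho> = sqrt (M / m) * norm x0 + 1"
  define B where "B = cball (0::(real^3) \<times> (real^3) \<times> (real^3)) \<rho>"
  \<comment> \<open>Projection onto the ball is nonexpansive, so \<open>F\<close> inherits the
    Lipschitz constant on the ball globally; comparison with the equilibrium at 0 bounds it by
    \<open>L * \<rho>\<close>.\<close>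
  define F where "F t y = f t (closest_point B y)" for t y
  define L where "L = (norm \<alpha> + 2 * \<rho> + k\<alpha>) + (norm \<beta> + 2 * \<rho> + k\<beta>) + (w + l\<alpha> * norm \<alpha> + l\<beta> * norm \<beta>)"
  have "sqrt (M / m) * norm x0 \<ge> 0"
    using m_M by simp
  then have \<rho>: "\<rho> > 0"
    unfolding \<rho>_def by linarith
  have L: "L > 0"
    unfolding L_def using pos \<rho> w_nonneg
    by (intro add_pos_nonneg add_nonneg_pos) auto
  have B: "closed B" "convex B" "B \<noteq> {}"
    using \<rho> by (auto simp: B_def)
  have cp: "norm (closest_point B y) \<le> \<rho>" for y
    using closest_point_in_set[OF B(1,3), of y] by (simp add: B_def)
  obtain D where D: "locally_finite_set D" "\<And>t. t \<in> {0..} - D \<Longrightarrow> continuous (at t within {0..}) \<Omega>"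
    using \<Omega>_piecewise unfolding piecewise_continuous_on_def by blast
  have "\<exists>x. ode_solution_on {t0..} F x \<and> x t0 = x0"
  proof (rule global_ode_solution[OF D(1), where L = L and B = "L * \<rho>"])
    fix t y assume t: "t \<in> {t0..} - D"
    have "continuous (at t within {t0..}) \<Omega>"
      using t t0 by (intro continuous_within_subset[OF D(2)]) auto
    then show "continuous (at t within {t0..}) (\<lambda>s. F s y)"
      unfolding F_def error_system_def case_prod_beta'
      by (intro continuous_intros continuous_cross continuous_const)
  next
    fix t y z assume t: "t \<ge> t0"
    have lip: "norm (f t y - f t z) \<le> L * norm (y - z)" if "norm y \<le> \<rho>" "norm z \<le> \<rho>" for y z
      unfolding L_def using t t0 that by (intro error_system_lipschitz_on_ball) auto
    show "norm (F t y - F t z) \<le> L * norm (y - z)"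
      unfolding F_def
      by (rule order_trans[OF lip[OF cp cp]])
        (use L closest_point_lipschitz[OF B(2,1,3), of y z] in \<open>simp add: dist_norm\<close>)
    have "norm (F t y - f t 0) \<le> L * norm (closest_point B y - 0)"
      unfolding F_def using \<rho> by (intro lip cp) auto
    also have "\<dots> \<le> L * \<rho>"
      using L cp by simp
    finally show "norm (F t y) \<le> L * \<rho>"
      by (simp add: equilibrium)
  qed (use L in auto)
  then obtain x where x: "ode_solution_on {t0..} F x" "x t0 = x0"
    by blast
  have radial: "\<exists>s\<ge>0. F t y = f t (s *\<^sub>R y)" for t y
    unfolding F_def B_def using closest_point_cball_radial[OF \<rho>, of y] by metis
  \<comment> \<open>\<open>V\<close> is nonincreasing for the truncated system too, so its solution
    never leaves the ball and solves the original system.\<close>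
  have "F t (x t) = f t (x t)" if t: "t \<in> {t0..}" for t
  proof -
    have "V (x t) \<le> V (x t0)"
      using t by (intro V_nonincreasing[OF ode_solution_on_subset[OF x(1), of "{t0..t}"] _ radial]) auto
    then have "norm (x t) \<le> \<rho>"
      using norm_le_of_V_le[of "x t" "x t0"] by (simp add: \<rho>_def x(2))
    then show ?thesis
      by (simp add: F_def B_def closest_point_self)
  qed
  then have "ode_solution_on {t0..} f x"
    using x(1) by (auto simp: ode_solution_on_def)
  with x(2) show ?thesis by blast
qed

text \<open>With the rate taken at \<open>norm x0\<close> the estimate is a KL bound. On the unit
  ball the nonincreasing rate is at least \<open>rate 1\<close>, which gives one exponential rate
  for all small initial states.\<close>

lemma stability:
  "uniformly_globally_asymptotically_stable f \<and> locally_exponentially_stable f"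
proof -
  obtain K rate where K: "K > 0" and rate: "continuous_on {0..} rate"
      "\<And>r. r \<ge> 0 \<Longrightarrow> rate r > 0" "antimono_on {0..} rate"
    and est: "\<And>t0 T x t. t0 \<ge> 0 \<Longrightarrow> ode_solution_on {t0..T} f x \<Longrightarrow> t \<in> {t0..T} \<Longrightarrow>
      norm (x t) \<le> K * norm (x t0) * exp (- rate (norm (x t0)) * (t - t0))"
    using exponential_estimate by blast
  have "uniformly_globally_asymptotically_stable f"
    unfolding uniformly_globally_asymptotically_stable_def
  proof (intro exI conjI allI impI)
    show "class_KL (\<lambda>r s. K * r * exp (- rate r * s))"
      by (rule class_KL_exponential[OF K rate])
    show "solutions_bounded_by f t0 x0 (\<lambda>s. K * norm x0 * exp (- rate (norm x0) * s))"
      if "t0 \<ge> 0" for t0 x0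
      unfolding solutions_bounded_by_def using solution_exists that est by blast
  qed
  moreover have "solutions_bounded_by f t0 x0 (\<lambda>s. K * norm x0 * exp (- rate 1 * s))"
    if t0: "t0 \<ge> 0" and x0: "norm x0 < 1" for t0 x0
    unfolding solutions_bounded_by_def
  proof (intro conjI allI impI ballI)
    fix T x t assume x: "ode_solution_on {t0..T} f x \<and> x t0 = x0" and t: "t \<in> {t0..T}"
    have "rate 1 \<le> rate (norm x0)"
      using rate(3) x0 by (simp add: monotone_on_def)
    then have "exp (- rate (norm x0) * (t - t0)) \<le> exp (- rate 1 * (t - t0))"
      using t by (simp add: mult_right_mono)
    then have "K * norm x0 * exp (- rate (norm x0) * (t - t0)) \<le> K * norm x0 * exp (- rate 1 * (t - t0))"
      using K by (intro mult_left_mono) auto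
    then show "norm (x t) \<le> K * norm x0 * exp (- rate 1 * (t - t0))"
      using est[OF t0 conjunct1[OF x] t] x by simp
  qed (rule solution_exists[OF t0])
  then have "locally_exponentially_stable f"
    unfolding locally_exponentially_stable_def
    using K rate(2)[of 1] by (intro exI[of _ 1] exI[of _ K] exI[of _ "rate 1"] conjI) auto
  ultimately show ?thesis by blast
qed

end

unbundle no cross3_syntax

section \<open>Stability of the observer error system\<close>

theorem theorem1:
  fixes \<omega> :: "real \<Rightarrow> real^3" and R :: "real \<Rightarrow> real^3^3"
    and \<Omega> :: "real \<Rightarrow> real^3"
    and \<alpha>i \<beta>i :: "real^3" and k\<alpha> k\<beta> l\<alpha> l\<beta> :: real
  assumes "bounded (\<omega> ` {0..})" and "piecewise_continuous_on {0..} \<omega>"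
    and "\<forall>t\<ge>0. rotation_matrix (R t)"
    and "ode_solution_on {0..} (\<lambda>t X. X ** cross_matrix (\<omega> t)) R"
    and "\<forall>t\<ge>0. \<Omega> t = R t *v \<omega> t"
    and "\<alpha>i \<noteq> \<beta>i" and "independent {\<alpha>i, \<beta>i}"
    and "k\<alpha> > 0" and "k\<beta> > 0" and "l\<alpha> > 0" and "l\<beta> > 0"
  shows "equilibrium_point (error_system \<alpha>i \<beta>i k\<alpha> k\<beta> l\<alpha> l\<beta> \<Omega>) 0 \<and>
    uniformly_globally_asymptotically_stable (error_system \<alpha>i \<beta>i k\<alpha> k\<beta> l\<alpha> l\<beta> \<Omega>) \<and>
    locally_exponentially_stable (error_system \<alpha>i \<beta>i k\<alpha> k\<beta> l\<alpha> l\<beta> \<Omega>)"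
proof -
  obtain w where w: "\<And>t. t \<ge> 0 \<Longrightarrow> norm (\<omega> t) \<le> w"
    using assms(1) by (auto simp: bounded_iff)
  \<comment> \<open>Rotations preserve the norm, so the bound on \<open>\<omega>\<close> passes to
    \<open>\<Omega>\<close>; \<open>R\<close> is continuous, so \<open>\<Omega>\<close> is
    continuous off the same exceptional set.\<close>
  interpret observer_error \<alpha>i \<beta>i k\<alpha> k\<beta> l\<alpha> l\<beta> w \<Omega>
  proof
    fix t :: real assume t: "t \<ge> 0"
    have "orthogonal_matrix (R t)"
      using assms(3) t by (simp add: rotation_matrix_def)
    then have "orthogonal_transformation (\<lambda>v. R t *v v)"
      by (simp add: orthogonal_transformation_matrix)
    then show "norm (\<Omega> t) \<le> w"
      using assms(5) w t by (simp add: orthogonal_transformation_norm)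
  next
    obtain D where D: "locally_finite_set D" "\<forall>t\<in>{0..} - D. continuous (at t within {0..}) \<omega>"
      using assms(2) unfolding piecewise_continuous_on_def by blast
    have "continuous (at t within {0..}) \<Omega>" if t: "t \<in> {0..} - D" for t
    proof -
      have "(R \<longlongrightarrow> R t) (at t within {0..})" "(\<omega> \<longlongrightarrow> \<omega> t) (at t within {0..})"
        using assms(4) D t by (auto simp: ode_solution_on_def continuous_on_def continuous_within)
      then have "((\<lambda>s. R s *v \<omega> s) \<longlongrightarrow> R t *v \<omega> t) (at t within {0..})"
        unfolding matrix_vector_mult_def by (intro tendsto_intros)
      moreover have "\<forall>\<^sub>F s in at t within {0..}. R s *v \<omega> s = \<Omega> s"
        using assms(5) by (auto simp: eventually_at_filter)
      ultimately show ?thesis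
        using assms(5) t by (simp add: continuous_within Lim_transform_eventually)
    qed
    then show "piecewise_continuous_on {0..} \<Omega>"
      using D(1) unfolding piecewise_continuous_on_def by blast
  qed (use assms in auto)
  show ?thesis
    using stability equilibrium by (simp add: equilibrium_point_def)
qed

end
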